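(* Let $0<q<1$, let $u,v>0$ and let $n\in\mathbb{Z}^{+}$. Then, for a function $f$ with iterated $q$-derivatives $D_q^{i}f$, $$N_q\left(D_q^{n}f(t)\right)(u;v)=\frac{v^{n}}{u^{n}}\,(N_qf)(u;v)-\sum_{i=0}^{n-1}\left(\frac{v}{u}\right)^{n-1-i}D_q^{i}f(0).$$
   Context: Fix $0<q<1$. The $q$-derivative is $(D_qf)(x)=\frac{f(x)-f(qx)}{(1-q)x}$ for $x\ne0$, and $(D_qf)(0)=f'(0)$ provided $f'(0)$ exists; $D_q^0f=f$ and $D_q^{i}f=D_q(D_q^{i-1}f)$. Write $[m]_q=\frac{1-q^m}{1-q}$, $[m]_q!=[m]_q[m-1]_q\cdots[1]_q$, $[0]_q!=1$, and $E_q(x)=\sum_{m=0}^{\infty}q^{m(m-1)/2}\frac{x^m}{[m]_q!}$ ($x\in\mathbb{C}$). The Jackson $q$-integral is $\int_0^{\infty}g(t)\,d_qt=(1-q)\sum_{k\in\mathbb{Z}}q^kg(q^k)$, provided the sum converges absolutely. The $q$-analogue of the Natural transform of first kind, with transform variables $u,v$, is $$(N_qg)(u;v)=\frac1u\int_0^{\infty}g(t)\,E_q\!\left(-q\frac{v}{u}t\right)d_qt,$$ introduced for functions $g$ in the set $A$ of those $g$ for which there are $M,\tau_1,\tau_2>0$ with $|g(t)|<Me^{|t|/\tau_j}$ for $t\in(-1)^j\times[0,\infty)$.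
   Formalization: The sum of boundary terms is multiplied by 1/u, which the printed formula omits; without it the identity fails, e.g. for n=1, u=2, f the indicator of [-1,1]. Absolute convergence of the q-integral defining N_q f at (u,v) is assumed; membership in A is not required. *)

theory Defs
  imports "HOL-Analysis.Analysis"
begin

definition q_number :: "real \<Rightarrow> nat \<Rightarrow> real" where
  "q_number q m = (1 - q ^ m) / (1 - q)"

definition q_fact :: "real \<Rightarrow> nat \<Rightarrow> real" where
  "q_fact q m = (\<Prod>j=1..m. q_number q j)"

definition q_exp :: "real \<Rightarrow> complex \<Rightarrow> complex" where
  "q_exp q x = (\<Sum>m. complex_of_real (q ^ (m * (m - 1) div 2)) * x ^ m / complex_of_real (q_fact q m))"

text \<open>At the origin the value is meaningful only if \<open>f\<close> is differentiable there;
  this has to be assumed separately. Iterates are \<open>(q_deriv q ^^ i) f\<close>.\<close>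

definition q_deriv :: "real \<Rightarrow> (real \<Rightarrow> complex) \<Rightarrow> real \<Rightarrow> complex" where
  "q_deriv q f x =
    (if x = 0 then vector_derivative f (at 0)
     else (f x - f (q * x)) / complex_of_real ((1 - q) * x))"

definition has_q_derivs :: "real \<Rightarrow> nat \<Rightarrow> (real \<Rightarrow> complex) \<Rightarrow> bool" where
  "has_q_derivs q n f \<longleftrightarrow> (\<forall>i<n. (q_deriv q ^^ i) f differentiable (at 0))"

definition jackson_integrable :: "real \<Rightarrow> (real \<Rightarrow> complex) \<Rightarrow> bool" where
  "jackson_integrable q g \<longleftrightarrow>
    (\<lambda>k::int. norm (complex_of_real (q powi k) * g (q powi k))) summable_on UNIV"

definition jackson_integral :: "real \<Rightarrow> (real \<Rightarrow> complex) \<Rightarrow> complex" where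
  "jackson_integral q g =
    complex_of_real (1 - q) * (\<Sum>\<^sub>\<infinity>k::int. complex_of_real (q powi k) * g (q powi k))"

definition q_natural_integrand ::
    "real \<Rightarrow> (real \<Rightarrow> complex) \<Rightarrow> real \<Rightarrow> real \<Rightarrow> real \<Rightarrow> complex" where
  "q_natural_integrand q g u v t = g t * q_exp q (complex_of_real (- q * (v / u) * t))"

definition q_natural_exists :: "real \<Rightarrow> (real \<Rightarrow> complex) \<Rightarrow> real \<Rightarrow> real \<Rightarrow> bool" where
  "q_natural_exists q g u v \<longleftrightarrow> jackson_integrable q (q_natural_integrand q g u v)"

definition q_natural :: "real \<Rightarrow> (real \<Rightarrow> complex) \<Rightarrow> real \<Rightarrow> real \<Rightarrow> complex" where
  "q_natural q g u v =
    complex_of_real (1 / u) * jackson_integral q (q_natural_integrand q g u v)"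

text \<open>The transform is homogeneous of degree \<open>-1\<close> in \<open>(u, v)\<close>. Hence in the rule for
  \<open>q\<close>-derivatives the boundary terms at the origin must carry the prefactor \<open>1/u\<close> too.\<close>

lemma q_natural_scale:
  assumes "r \<noteq> 0"
  shows "q_natural q g (r * u) (r * v) = q_natural q g u v / complex_of_real r"
  using assms by (simp add: q_natural_def q_natural_integrand_def[abs_def] ac_simps)

end

theory Submission
  imports Defs
begin

text \<open>
  The rule is an iterated integration by parts. Put \<open>a = v / u\<close> and \<open>E t = E\<^sub>q (- a t)\<close>. The kernel
  of the transform is the dilate \<open>E (q t)\<close>, and the \<open>q\<close>-exponential satisfies
  \<open>E t = (1 - (1 - q) a t) E (q t)\<close> (lemma \<open>q_exp_functional_equation\<close>), that is,
  \<open>D\<^sub>q E t = - a E (q t)\<close>. On the lattice of points \<open>t = q\<^sup>k\<close> with \<open>k\<close> an integer, this makes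
  \<open>(f t - f (q t)) E (q t) = (1 - q) a t f t E (q t) + (f t E t - f (q t) E (q t))\<close>.
  Summed over \<open>k\<close>, the left-hand side gives the Jackson integral of \<open>D\<^sub>q f\<close> against the kernel,
  the first term on the right gives \<open>a\<close> times that of \<open>f\<close>, and the last one telescopes
  to the difference between the limits of \<open>f E\<close> at infinity and at the origin.

  The hypotheses on \<open>f\<close> control both ends of the lattice. At infinity, absolute convergence of the integral
  of \<open>f\<close> forces \<open>t f t E (q t)\<close> to be summable along the lattice; since \<open>E t\<close> exceeds
  \<open>E (q t)\<close> by a factor of order \<open>t\<close> only, \<open>f E\<close> is summable there too and hence
  tends to zero. At the origin, \<open>f E\<close> tends to \<open>f 0\<close> by
  continuity, and differentiability makes \<open>D\<^sub>q f\<close> bounded along the lattice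
  (lemma \<open>q_deriv_tendsto_at_0\<close>), so that \<open>D\<^sub>q f\<close> inherits absolute convergence. The resulting
  first-order rule (lemma \<open>q_natural_q_deriv\<close>) therefore reproduces its own integrability
  hypothesis and can be iterated.
\<close>

section \<open>The \<open>q\<close>-exponential series\<close>

lemma q_number_pos:
  assumes "0 < q" "q < 1" "0 < m"
  shows "0 < q_number q m"
proof -
  have "q ^ m < 1" using assms by (simp add: power_less_one_iff)
  then show ?thesis using assms by (simp add: q_number_def)
qed

lemma q_fact_0 [simp]: "q_fact q 0 = 1"
  by (simp add: q_fact_def)

lemma q_fact_Suc: "q_fact q (Suc m) = q_fact q m * q_number q (Suc m)"
  by (simp add: q_fact_def)

definition q_exp_coeff :: "real \<Rightarrow> nat \<Rightarrow> complex" where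
  "q_exp_coeff q m = complex_of_real (q ^ (m * (m - 1) div 2) / q_fact q m)"

lemma q_exp_powser: "q_exp q x = (\<Sum>m. q_exp_coeff q m * x ^ m)"
  by (simp add: q_exp_def q_exp_coeff_def)

lemma q_exp_coeff_0 [simp]: "q_exp_coeff q 0 = 1"
  by (simp add: q_exp_coeff_def)

lemma q_exp_coeff_Suc:
  "q_exp_coeff q (Suc m) = q_exp_coeff q m * complex_of_real (q ^ m / q_number q (Suc m))"
proof -
  have "even (m * (m - 1))" by (cases m) auto
  then have "Suc m * (Suc m - 1) div 2 = m * (m - 1) div 2 + m"
    by (cases m) (auto elim!: evenE)
  then show ?thesis
    by (simp add: q_exp_coeff_def q_fact_Suc power_add)
qed

text \<open>The ratio of successive terms is \<open>q\<^sup>m x / [m + 1]\<^sub>q\<close>. It tends to zero because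
  \<open>[m + 1]\<^sub>q\<close> tends to \<open>1 / (1 - q)\<close>, so the series is entire.\<close>

lemma summable_q_exp_powser:
  assumes "0 < q" "q < 1"
  shows "summable (\<lambda>m. q_exp_coeff q m * x ^ m)"
proof -
  have "(\<lambda>m. q ^ m / q_number q (Suc m) * norm x) \<longlonglongrightarrow> 0 / ((1 - 0) / (1 - q)) * norm x"
    unfolding q_number_def using assms
    by (intro tendsto_intros LIMSEQ_Suc[OF LIMSEQ_power_zero] LIMSEQ_power_zero) auto
  then have "(\<lambda>m. q ^ m / q_number q (Suc m) * norm x) \<longlonglongrightarrow> 0" by simp
  then have "eventually (\<lambda>m. q ^ m / q_number q (Suc m) * norm x < 1 / 2) sequentially"
    by (rule order_tendstoD) simp
  then obtain N where N: "\<And>m. m \<ge> N \<Longrightarrow> q ^ m / q_number q (Suc m) * norm x < 1 / 2"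
    by (auto simp: eventually_sequentially)
  show ?thesis
  proof (rule summable_ratio_test[of "1 / 2" N])
    fix m assume "N \<le> m"
    have "norm (q_exp_coeff q (Suc m) * x ^ Suc m)
        = norm (q_exp_coeff q m * x ^ m) * (q ^ m / q_number q (Suc m) * norm x)"
      using assms q_number_pos[OF assms, of "Suc m"]
      by (simp add: q_exp_coeff_Suc norm_mult norm_power norm_divide)
    also have "\<dots> \<le> norm (q_exp_coeff q m * x ^ m) * (1 / 2)"
      using N[OF \<open>N \<le> m\<close>] by (intro mult_left_mono) auto
    finally show "norm (q_exp_coeff q (Suc m) * x ^ Suc m)
        \<le> 1 / 2 * norm (q_exp_coeff q m * x ^ m)" by simp
  qed simp
qed

lemma q_exp_0 [simp]: "q_exp q 0 = 1"
  by (simp add: q_exp_powser)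

lemma isCont_q_exp:
  assumes "0 < q" "q < 1"
  shows "isCont (q_exp q) x"
  unfolding q_exp_powser[abs_def]
  by (rule isCont_powser[of _ "of_real (norm x + 1)"])
     (use summable_q_exp_powser[OF assms] in auto)

text \<open>This is \<open>D\<^sub>q E\<^sub>q x = E\<^sub>q (q x)\<close>, written without division. Coefficientwise it is the
  recurrence of the series, since \<open>1 - q\<^sup>m\<^sup>+\<^sup>1 = (1 - q) [m + 1]\<^sub>q\<close>.\<close>

lemma q_exp_functional_equation:
  assumes "0 < q" "q < 1"
  shows "q_exp q x = (1 + complex_of_real (1 - q) * x) * q_exp q (complex_of_real q * x)"
proof -
  let ?c = "q_exp_coeff q" and ?q = "complex_of_real q"
  have c: "?c (Suc m) * (1 - ?q ^ Suc m) = (1 - ?q) * (?c m * ?q ^ m)" for m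
  proof -
    have "(1 - q ^ Suc m) * (q ^ m / q_number q (Suc m)) = (1 - q) * q ^ m"
      using q_number_pos[OF assms, of "Suc m"] assms
      by (simp add: q_number_def field_simps)
    then have "(1 - ?q ^ Suc m) * complex_of_real (q ^ m / q_number q (Suc m)) = (1 - ?q) * ?q ^ m"
      by (metis of_real_1 of_real_diff of_real_mult of_real_power)
    then show ?thesis
      unfolding q_exp_coeff_Suc by (simp only: ac_simps)
  qed
  note S = summable_q_exp_powser[OF assms]
  have "q_exp q x - q_exp q (?q * x) = (\<Sum>m. ?c m * x ^ m - ?c m * (?q * x) ^ m)"
    unfolding q_exp_powser by (rule suminf_diff[OF S S])
  also have "\<dots> = (\<Sum>m. ?c (Suc m) * x ^ Suc m - ?c (Suc m) * (?q * x) ^ Suc m)"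
    using suminf_split_head[OF summable_diff[OF S[of x] S[of "?q * x"]]] by simp
  also have "\<dots> = (\<Sum>m. (1 - ?q) * x * (?c m * (?q * x) ^ m))"
  proof (rule suminf_cong)
    fix m
    have "?c (Suc m) * x ^ Suc m - ?c (Suc m) * (?q * x) ^ Suc m
        = ?c (Suc m) * (1 - ?q ^ Suc m) * x ^ Suc m"
      by (simp add: power_mult_distrib algebra_simps)
    then show "?c (Suc m) * x ^ Suc m - ?c (Suc m) * (?q * x) ^ Suc m
        = (1 - ?q) * x * (?c m * (?q * x) ^ m)"
      unfolding c by (simp add: power_mult_distrib algebra_simps)
  qed
  also have "\<dots> = (1 - ?q) * x * q_exp q (?q * x)"
    unfolding q_exp_powser by (rule suminf_mult[OF S])
  finally show ?thesis by (simp add: algebra_simps)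
qed

section \<open>The \<open>q\<close>-derivative at the origin\<close>

text \<open>With the difference quotient \<open>s x = (f x - f 0) / x\<close>, the \<open>q\<close>-derivative is
  \<open>(s x - q s (q x)) / (1 - q)\<close>, and both values of \<open>s\<close> tend to the ordinary
  derivative at the origin.\<close>

lemma q_deriv_tendsto_at_0:
  assumes "0 < q" "q < 1" "f differentiable (at 0)"
  shows "(q_deriv q f \<longlongrightarrow> q_deriv q f 0) (at 0)"
proof -
  define d where "d = vector_derivative f (at 0)"
  let ?s = "\<lambda>x. (f x - f 0) /\<^sub>R x"
  have "(f has_vector_derivative d) (at 0)"
    using assms(3) by (simp add: d_def vector_derivative_works)
  then have "((\<lambda>x. norm (f x - f 0 - x *\<^sub>R d) / norm x) \<longlongrightarrow> 0) (at 0)"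
    by (simp add: has_vector_derivative_def has_derivative_iff_norm)
  moreover have "eventually (\<lambda>x. norm (f x - f 0 - x *\<^sub>R d) / norm x = norm (?s x - d)) (at 0)"
  proof -
    have "norm (f x - f 0 - x *\<^sub>R d) / norm x = norm (?s x - d)" if "x \<noteq> 0" for x
    proof -
      have "?s x - d = (f x - f 0 - x *\<^sub>R d) /\<^sub>R x" using that by (simp add: scaleR_diff_right)
      then show ?thesis by (simp add: divide_inverse)
    qed
    then show ?thesis by (simp add: eventually_at_filter)
  qed
  ultimately have "((\<lambda>x. norm (?s x - d)) \<longlongrightarrow> 0) (at 0)"
    by (rule Lim_transform_eventually)
  then have s: "(?s \<longlongrightarrow> d) (at 0)"
    by (simp only: tendsto_norm_zero_iff LIM_zero_iff)
  have "filterlim (\<lambda>x. q * x) (at 0) (at 0)"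
    unfolding filterlim_at using assms
    by (auto intro!: tendsto_eq_intros simp: eventually_at_filter)
  from filterlim_compose[OF s this]
  have sq: "((\<lambda>x. ?s (q * x)) \<longlongrightarrow> d) (at 0)" .
  have "((\<lambda>x. (?s x - of_real q * ?s (q * x)) / of_real (1 - q))
      \<longlongrightarrow> (d - of_real q * d) / of_real (1 - q)) (at 0)"
    using assms by (intro tendsto_intros s sq) auto
  also have "(d - of_real q * d) / of_real (1 - q) = d"
    using assms by (simp add: field_simps)
  finally have "((\<lambda>x. (?s x - of_real q * ?s (q * x)) / of_real (1 - q)) \<longlongrightarrow> d) (at 0)" .
  moreover have "eventually (\<lambda>x. (?s x - of_real q * ?s (q * x)) / of_real (1 - q) = q_deriv q f x) (at 0)"
    using assms
    by (auto simp: eventually_at_filter q_deriv_def scaleR_conv_of_real field_simps)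
  ultimately have "(q_deriv q f \<longlongrightarrow> d) (at 0)"
    by (rule Lim_transform_eventually)
  then show ?thesis by (simp add: q_deriv_def d_def)
qed

section \<open>Sums over the integers\<close>

lemma filterlim_symmetric_int_intervals:
  "filterlim (\<lambda>N. {- int N..<int N}) (finite_subsets_at_top UNIV) sequentially"
  unfolding filterlim_finite_subsets_at_top
proof (intro allI impI)
  fix X :: "int set" assume X: "finite X \<and> X \<subseteq> UNIV"
  then obtain B where B: "\<And>x. x \<in> X \<Longrightarrow> \<bar>x\<bar> \<le> B"
    by (metis bdd_above_def bdd_above_finite finite_imageI image_eqI)
  show "eventually (\<lambda>N. finite {- int N..<int N} \<and> X \<subseteq> {- int N..<int N} \<and> {- int N..<int N} \<subseteq> UNIV) sequentially"
    using eventually_gt_at_top[of "nat B"]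
  proof eventually_elim
    case (elim N)
    then show ?case using B by fastforce
  qed
qed

text \<open>An unconditional sum over the integers may be computed along any exhaustion by finite
  sets; along symmetric intervals the partial sums collapse.\<close>

lemma infsum_telescope_int:
  fixes h :: "int \<Rightarrow> 'a :: real_normed_vector"
  assumes "(\<lambda>k. h k - h (k + 1)) summable_on UNIV"
    and "(\<lambda>N. h (- int N)) \<longlonglongrightarrow> a" and "(\<lambda>N. h (int N)) \<longlonglongrightarrow> b"
  shows "(\<Sum>\<^sub>\<infinity>k. h k - h (k + 1)) = a - b"
proof -
  have partial: "(\<Sum>k\<in>{- int N..<int N}. h k - h (k + 1)) = h (- int N) - h (int N)" for N
  proof (induction N)
    case (Suc N)
    have "{- int (Suc N)..<int (Suc N)} = insert (- 1 - int N) (insert (int N) {- int N..<int N})"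
      by auto
    with Suc show ?case by (simp add: algebra_simps)
  qed simp
  have "(sum (\<lambda>k. h k - h (k + 1)) \<longlongrightarrow> (\<Sum>\<^sub>\<infinity>k. h k - h (k + 1))) (finite_subsets_at_top UNIV)"
    using infsum_tendsto[OF assms(1)] .
  from filterlim_compose[OF this filterlim_symmetric_int_intervals]
  have "(\<lambda>N. h (- int N) - h (int N)) \<longlonglongrightarrow> (\<Sum>\<^sub>\<infinity>k. h k - h (k + 1))"
    by (simp add: partial)
  moreover have "(\<lambda>N. h (- int N) - h (int N)) \<longlonglongrightarrow> a - b"
    using assms(2,3) by (rule tendsto_diff)
  ultimately show ?thesis by (rule LIMSEQ_unique)
qed

lemma summable_on_nonneg_int_iff:
  "g summable_on {0::int..} \<longleftrightarrow> (\<lambda>n::nat. g (int n)) summable_on UNIV"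
proof -
  have "range int = {0..}"
    by (auto simp: image_iff) (metis nonneg_int_cases)
  then show ?thesis
    using summable_on_reindex[of int UNIV g] by (simp add: o_def)
qed

text \<open>The part of the lattice near the origin carries the geometric weights \<open>q\<^sup>k\<close>, and \<open>g\<close> is
  bounded along it because it has a limit, so a geometric series dominates the sum.\<close>

lemma jackson_summable_near_0:
  fixes g :: "real \<Rightarrow> complex"
  assumes "0 < q" "q < 1" and "(g \<longlongrightarrow> l) (at 0)"
  shows "(\<lambda>k::int. norm (complex_of_real (q powi k) * g (q powi k))) summable_on {0..}"
proof -
  have "filterlim (\<lambda>n. q ^ n) (at 0) sequentially"
    unfolding filterlim_at using assms by (auto intro: LIMSEQ_power_zero)
  from filterlim_compose[OF assms(3) this]
  have "Bseq (\<lambda>n. g (q ^ n))" by (rule convergent_imp_Bseq[OF convergentI])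
  then obtain C where C: "\<And>n. norm (g (q ^ n)) \<le> C" by (auto simp: Bseq_def)
  have "(\<lambda>n. norm (complex_of_real (q powi int n) * g (q powi int n))) summable_on UNIV"
  proof (rule summable_on_comparison_test)
    show "(\<lambda>n. q ^ n * C) summable_on UNIV"
      by (intro norm_summable_imp_summable_on)
         (use assms in \<open>simp add: norm_mult summable_mult2 summable_geometric abs_mult norm_power power_abs\<close>)
  qed (use assms C in \<open>auto simp: norm_mult norm_power intro!: mult_left_mono\<close>)
  then show ?thesis by (simp only: summable_on_nonneg_int_iff)
qed

section \<open>Integration by parts\<close>

text \<open>The boundary function is \<open>h\<close>, the sequence of values of \<open>f E\<close> on the lattice. Splitting
  the integrand \<open>T\<close> of \<open>D\<^sub>q f\<close> into multiples of \<open>w\<close> and differences of \<open>h\<close> is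
  only legitimate once \<open>T\<close> is known to be summable, which is shown separately for
  \<open>t \<le> 1\<close> and \<open>t > 1\<close>.\<close>

lemma jackson_q_exp_by_parts:
  fixes a q :: real and f :: "real \<Rightarrow> complex"
  defines "e \<equiv> \<lambda>t. q_exp q (complex_of_real (- q * a * t))"
  assumes q: "0 < q" "q < 1" and diff: "f differentiable (at 0)"
    and int: "jackson_integrable q (\<lambda>t. f t * e t)"
  shows "jackson_integrable q (\<lambda>t. q_deriv q f t * e t)" (is ?A)
    and "jackson_integral q (\<lambda>t. q_deriv q f t * e t)
      = complex_of_real a * jackson_integral q (\<lambda>t. f t * e t) - f 0" (is ?B)
proof -
  define E where "E = (\<lambda>t::real. q_exp q (complex_of_real (- a * t)))"
  define r where "r = (\<lambda>k::int. q powi k)"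
  define h where "h = (\<lambda>k. f (r k) * E (r k))"
  define w where "w = (\<lambda>k. complex_of_real (r k) * (f (r k) * e (r k)))"
  define c where "c = 1 + (1 - q) * \<bar>a\<bar>"
  have r_pos: "r k > 0" for k using q by (simp add: r_def)
  have r_Suc: "r (k + 1) = q * r k" for k
    using q by (simp add: r_def power_int_add)
  have r_ge_1: "r k \<ge> 1" if "k \<le> 0" for k
  proof -
    have "q ^ nat (- k) \<le> 1" using q by (intro power_le_one) auto
    then show ?thesis using q that by (simp add: r_def power_int_def field_simps one_le_inverse_iff)
  qed
  have e_E: "e t = E (q * t)" for t by (simp add: e_def E_def ac_simps)
  have E_eq: "E t = (1 - of_real ((1 - q) * a * t)) * e t" for t
    using q_exp_functional_equation[OF q, of "complex_of_real (- a * t)"]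
    by (simp add: E_def e_def ac_simps)
  have w_summable: "(\<lambda>k. norm (w k)) summable_on UNIV"
    using int by (simp add: jackson_integrable_def w_def r_def)
  define T where "T = (\<lambda>k. complex_of_real (r k) * (q_deriv q f (r k) * e (r k)))"
  have T_eq: "of_real (1 - q) * T k = f (r k) * e (r k) - h (k + 1)" for k
  proof -
    have "r k \<noteq> 0" using r_pos[of k] by simp
    then have "complex_of_real (1 - q) * (of_real (r k) * q_deriv q f (r k)) = f (r k) - f (q * r k)"
      using q by (simp add: q_deriv_def)
    moreover have "complex_of_real (1 - q) * T k =
        complex_of_real (1 - q) * (of_real (r k) * q_deriv q f (r k)) * e (r k)"
      unfolding T_def by (simp only: mult.assoc)
    ultimately show ?thesis by (simp only: h_def r_Suc e_E left_diff_distrib)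
  qed
  have h_eq: "h k = f (r k) * e (r k) - of_real ((1 - q) * a) * w k" for k
    by (simp add: h_def w_def E_eq algebra_simps)
  have fe_le: "norm (f (r k) * e (r k)) \<le> norm (w k)" if "k \<le> 0" for k
    using mult_right_mono[OF r_ge_1[OF that], of "norm (f (r k) * e (r k))"] r_pos[of k]
    by (simp add: w_def norm_mult)
  \<comment> \<open>Where \<open>t \<ge> 1\<close>, the weight \<open>t\<close> in the integrand of \<open>f\<close> pays for the factor
    \<open>1 - (1 - q) a t\<close> that separates \<open>E t\<close> from the kernel.\<close>
  have h_le: "norm (h k) \<le> c * norm (w k)" if "k \<le> 0" for k
  proof -
    have "norm (h k) \<le> norm (f (r k) * e (r k)) + norm (of_real ((1 - q) * a) * w k)"
      unfolding h_eq by (rule norm_triangle_ineq4)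
    also have "norm (of_real ((1 - q) * a) * w k) = (1 - q) * \<bar>a\<bar> * norm (w k)"
      using q by (simp add: norm_mult abs_mult del: of_real_mult of_real_diff)
    finally show ?thesis using fe_le[OF that] by (simp add: c_def algebra_simps)
  qed
  have T_summable: "(\<lambda>k. norm (T k)) summable_on UNIV"
  proof -
    have "isCont (\<lambda>t. e t) 0"
      unfolding e_def by (intro continuous_intros isCont_o2[OF _ isCont_q_exp[OF q]])
    then have "((\<lambda>t. q_deriv q f t * e t) \<longlongrightarrow> q_deriv q f 0 * e 0) (at 0)"
      by (intro tendsto_mult q_deriv_tendsto_at_0[OF q diff]) (simp add: isCont_def)
    from jackson_summable_near_0[OF q this]
    have pos: "(\<lambda>k. norm (T k)) summable_on {0..}" by (simp add: T_def r_def)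
    have w_shift: "(\<lambda>k. norm (w (k + 1))) summable_on UNIV"
      using w_summable summable_on_reindex_bij_betw[of "\<lambda>k::int. k + 1" UNIV UNIV "\<lambda>k. norm (w k)"]
      by (simp add: bij_plus_right)
    have neg: "(\<lambda>k. norm (T k)) summable_on {..<0}"
    proof (rule summable_on_comparison_test)
      have "(\<lambda>k. (norm (w k) + c * norm (w (k + 1))) * inverse (1 - q)) summable_on UNIV"
        by (intro summable_on_cmult_left summable_on_add summable_on_cmult_right w_summable w_shift)
      then show "(\<lambda>k. (norm (w k) + c * norm (w (k + 1))) * inverse (1 - q)) summable_on {..<0}"
        by (rule summable_on_subset_banach) simp
    next
      fix k :: int assume k: "k \<in> {..<0}"
      have "(1 - q) * norm (T k) = norm (of_real (1 - q) * T k)"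
        using q by (simp add: norm_mult del: of_real_diff)
      also have "\<dots> \<le> norm (f (r k) * e (r k)) + norm (h (k + 1))"
        unfolding T_eq by (rule norm_triangle_ineq4)
      also have "\<dots> \<le> norm (w k) + c * norm (w (k + 1))"
        using k by (intro add_mono fe_le h_le) auto
      finally show "norm (T k) \<le> (norm (w k) + c * norm (w (k + 1))) * inverse (1 - q)"
        using q by (simp add: field_simps)
    qed simp
    have "(\<lambda>k. norm (T k)) summable_on ({0..} \<union> {..<0})"
      by (rule summable_on_Un_disjoint[OF pos neg]) auto
    moreover have "{0..} \<union> {..<0} = (UNIV :: int set)" by auto
    ultimately show ?thesis by simp
  qed
  then show ?A by (simp add: jackson_integrable_def T_def r_def)
  have T_split: "of_real (1 - q) * T k + (- of_real ((1 - q) * a)) * w k = h k - h (k + 1)" for k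
    unfolding T_eq h_eq[of k] by simp
  have T_sum: "T summable_on UNIV" and w_sum: "w summable_on UNIV"
    using T_summable w_summable by (simp_all add: abs_summable_summable)
  have h_top: "(\<lambda>N. h (int N)) \<longlonglongrightarrow> f 0"
  proof -
    have "isCont E 0"
      unfolding E_def by (intro continuous_intros isCont_o2[OF _ isCont_q_exp[OF q]])
    moreover have "isCont f 0" using diff by (rule differentiable_imp_continuous_within)
    ultimately have "isCont (\<lambda>t. f t * E t) 0" by (intro continuous_intros)
    from isCont_tendsto_compose[OF this LIMSEQ_power_zero[of q]] q
    show ?thesis by (simp add: h_def r_def E_def power_int_of_nat)
  qed
  have h_bot: "(\<lambda>N. h (- int N)) \<longlonglongrightarrow> 0"
  proof (rule Lim_null_comparison)
    show "eventually (\<lambda>N. norm (h (- int N)) \<le> c * norm (w (- int N))) sequentially"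
      using h_le by simp
    have "(\<lambda>N. norm (w (- int N))) summable_on UNIV"
    proof -
      have "inj (\<lambda>N. - int N)" by (simp add: inj_def)
      from summable_on_reindex[OF this, of "\<lambda>k. norm (w k)"]
      show ?thesis using summable_on_subset_banach[OF w_summable] by (simp add: o_def)
    qed
    then have "summable (\<lambda>N. norm (w (- int N)))" by (rule summable_on_imp_summable)
    then have "(\<lambda>N. norm (w (- int N))) \<longlonglongrightarrow> 0" by (rule summable_LIMSEQ_zero)
    then show "(\<lambda>N. c * norm (w (- int N))) \<longlonglongrightarrow> 0" by (rule tendsto_mult_right_zero)
  qed
  have "((\<lambda>k. of_real (1 - q) * T k + (- of_real ((1 - q) * a)) * w k) has_sum
      of_real (1 - q) * infsum T UNIV + (- of_real ((1 - q) * a)) * infsum w UNIV) UNIV"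
    by (intro has_sum_add has_sum_cmult_right has_sum_infsum T_sum w_sum)
  then have h_sum: "((\<lambda>k. h k - h (k + 1)) has_sum
      of_real (1 - q) * infsum T UNIV + (- of_real ((1 - q) * a)) * infsum w UNIV) UNIV"
    unfolding T_split .
  have "of_real (1 - q) * infsum T UNIV + (- of_real ((1 - q) * a)) * infsum w UNIV = 0 - f 0"
    using infsumI[OF h_sum] infsum_telescope_int[OF has_sum_imp_summable[OF h_sum] h_bot h_top]
    by simp
  then show ?B
    by (simp add: jackson_integral_def T_def w_def r_def algebra_simps)
qed

section \<open>The transform of iterated \<open>q\<close>-derivatives\<close>

lemma q_natural_q_deriv:
  assumes q: "0 < q" "q < 1" and "f differentiable (at 0)" and "q_natural_exists q f u v"
  shows "q_natural_exists q (q_deriv q f) u v"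
    and "q_natural q (q_deriv q f) u v =
      complex_of_real (v / u) * q_natural q f u v - complex_of_real (1 / u) * f 0"
proof -
  have "jackson_integrable q (\<lambda>t. f t * q_exp q (complex_of_real (- q * (v / u) * t)))"
    using assms(4) by (simp add: q_natural_exists_def q_natural_integrand_def[abs_def])
  note parts = jackson_q_exp_by_parts[OF q assms(3) this]
  show "q_natural_exists q (q_deriv q f) u v"
    using parts(1) by (simp add: q_natural_exists_def q_natural_integrand_def[abs_def])
  show "q_natural q (q_deriv q f) u v =
      complex_of_real (v / u) * q_natural q f u v - complex_of_real (1 / u) * f 0"
    unfolding q_natural_def q_natural_integrand_def[abs_def] parts(2)
    by (simp add: algebra_simps)
qed

text \<open>Each further \<open>q\<close>-derivative multiplies the previous boundary terms by \<open>v / u\<close> and adds the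
  value of the last iterate at the origin, whence the decreasing powers of \<open>v / u\<close> in the sum.\<close>

lemma q_natural_funpow_q_deriv:
  assumes q: "0 < q" "q < 1" and "has_q_derivs q n f" and "q_natural_exists q f u v"
  shows "q_natural_exists q ((q_deriv q ^^ n) f) u v \<and>
    q_natural q ((q_deriv q ^^ n) f) u v =
      complex_of_real ((v / u) ^ n) * q_natural q f u v
      - complex_of_real (1 / u) *
        (\<Sum>i<n. complex_of_real ((v / u) ^ (n - 1 - i)) * (q_deriv q ^^ i) f 0)"
  using assms(3)
proof (induction n)
  case 0
  then show ?case using assms(4) by simp
next
  case (Suc m)
  let ?a = "complex_of_real (v / u)" and ?D = "\<lambda>i. (q_deriv q ^^ i) f"
  let ?S = "\<lambda>m. \<Sum>i<m. complex_of_real ((v / u) ^ (m - 1 - i)) * ?D i 0"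
  have "has_q_derivs q m f" and diff: "?D m differentiable (at 0)"
    using Suc.prems by (simp_all add: has_q_derivs_def)
  with Suc.IH have ex: "q_natural_exists q (?D m) u v"
    and IH: "q_natural q (?D m) u v
      = complex_of_real ((v / u) ^ m) * q_natural q f u v - complex_of_real (1 / u) * ?S m"
    by blast+
  note step = q_natural_q_deriv[OF q diff ex]
  have "?a * ?S m = (\<Sum>i<m. complex_of_real ((v / u) ^ (m - i)) * ?D i 0)"
  proof (unfold sum_distrib_left, rule sum.cong[OF refl])
    fix i assume "i \<in> {..<m}"
    then have "m - i = Suc (m - 1 - i)" by auto
    then show "?a * (complex_of_real ((v / u) ^ (m - 1 - i)) * ?D i 0)
        = complex_of_real ((v / u) ^ (m - i)) * ?D i 0"
      by (simp only: power_Suc of_real_mult mult.assoc)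
  qed
  then have S_Suc: "?S (Suc m) = ?a * ?S m + ?D m 0" by simp
  have "q_natural q (?D (Suc m)) u v
      = ?a * (complex_of_real ((v / u) ^ m) * q_natural q f u v - complex_of_real (1 / u) * ?S m)
        - complex_of_real (1 / u) * ?D m 0"
    using step(2) by (simp only: IH funpow.simps o_apply)
  also have "\<dots> = complex_of_real ((v / u) ^ Suc m) * q_natural q f u v
      - complex_of_real (1 / u) * ?S (Suc m)"
    unfolding S_Suc power_Suc of_real_mult by (simp add: algebra_simps)
  finally show ?case using step(1) by simp
qed

theorem theorem7:
  fixes q u v :: real and n :: nat and f :: "real \<Rightarrow> complex"
  assumes "0 < q" and "q < 1"
    and "0 < u" and "0 < v"
    and "1 \<le> n"
    and "has_q_derivs q n f"
    and "q_natural_exists q f u v"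
  shows "q_natural_exists q ((q_deriv q ^^ n) f) u v \<and>
    q_natural q ((q_deriv q ^^ n) f) u v =
      complex_of_real (v ^ n / u ^ n) * q_natural q f u v
      - complex_of_real (1 / u) *
        (\<Sum>i=0..n-1. complex_of_real ((v / u) ^ (n - 1 - i)) * (q_deriv q ^^ i) f 0)"
proof -
  have "{0..n - 1} = {..<n}" using assms(5) by auto
  then show ?thesis
    using q_natural_funpow_q_deriv[OF assms(1,2,6,7)] by (simp add: power_divide)
qed

end
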